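(* The category $\mathcal{L}\mathrm{ens}$ has an orthogonal factorisation system which factors every lens into a surjective-on-objects lens followed by a cosieve. That is, the pair $(\mathcal{E},\mathcal{M})$ is an orthogonal factorisation system on $\mathcal{L}\mathrm{ens}$, where $\mathcal{E}$ is the class of lenses whose underlying functor is surjective on objects (these being exactly the epimorphisms of $\mathcal{L}\mathrm{ens}$) and $\mathcal{M}$ is the class of lenses whose underlying functor is a cosieve (these being exactly the monomorphisms of $\mathcal{L}\mathrm{ens}$).
   Context: All categories that are objects of $\mathcal{L}\mathrm{ens}$ are small. A (delta) lens $(f,\varphi)\colon A \rightleftharpoons B$ between small categories consists of a functor $f\colon A\to B$ together with a lifting operation assigning to each pair ($a\in A$, $u\colon fa\to b$ in $B$) a morphism $\varphi(a,u)\colon a\to a'$ of $A$ with domain $a$, such that (1) $f\varphi(a,u)=u$; (2) $\varphi(a,1_{fa})=1_a$; (3) $\varphi(a,v\circ u)=\varphi(a',v)\circ\varphi(a,u)$, where $a'$ is the codomain of $\varphi(a,u)$. $\mathcal{L}\mathrm{ens}$ is the category with small categories as objects and lenses as morphisms; the composite of $(f,\varphi)\colon A\rightleftharpoons B$ and $(g,\gamma)\colon B\rightleftharpoons C$ is the functor $g\circ f$ with lifting operation $(a,u\colon gfa\to c)\mapsto \varphi(a,\gamma(fa,u))$, and the identity lens on $A$ is the identity functor with lifting operation $(a,u)\mapsto u$. A functor $f\colon A\to B$ is a discrete opfibration if for all pairs ($a\in A$, $u\colon fa\to b$ in $B$) there is a unique morphism $w\colon a\to a'$ in $A$ with domain $a$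 and $fw=u$; a discrete opfibration carries a unique lens structure. A cosieve is an injective-on-objects discrete opfibration (equivalently, a fully faithful discrete opfibration whose object map is injective). *)

theory Defs
  imports "HOL-Library.FuncSet" "HOL-Library.Equipollence"
begin

section \<open>Categories\<close>

record ('o, 'm) cat =
  Obj :: "'o set"
  Arr :: "'m set"
  Dom :: "'m \<Rightarrow> 'o"
  Cod :: "'m \<Rightarrow> 'o"
  Ident :: "'o \<Rightarrow> 'm"
  Comp :: "'m \<Rightarrow> 'm \<Rightarrow> 'm"

text \<open>\<open>Comp C g f\<close> is the composite \<open>g \<circ> f\<close>, so \<open>f\<close> comes first.\<close>

definition composable :: "('o, 'm) cat \<Rightarrow> 'm \<Rightarrow> 'm \<Rightarrow> bool" where
  "composable C g f \<longleftrightarrow> f \<in> Arr C \<and> g \<in> Arr C \<and> Cod C f = Dom C g"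

text \<open>
  The structure maps are required to be \<open>undefined\<close> off their domains of definition
  (the \<open>extensional\<close> and \<open>comp_undef\<close> assumptions), so that equality of records is
  equality of categories. The same convention is used for functors and lenses below.
\<close>

locale category =
  fixes C :: "('o, 'm) cat"
  assumes dom_closed: "Dom C \<in> Arr C \<rightarrow>\<^sub>E Obj C"
    and cod_closed: "Cod C \<in> Arr C \<rightarrow>\<^sub>E Obj C"
    and ident_closed: "Ident C \<in> Obj C \<rightarrow>\<^sub>E Arr C"
    and dom_ident: "x \<in> Obj C \<Longrightarrow> Dom C (Ident C x) = x"
    and cod_ident: "x \<in> Obj C \<Longrightarrow> Cod C (Ident C x) = x"
    and comp_closed: "composable C g f \<Longrightarrow> Comp C g f \<in> Arr C"
    and dom_comp: "composable C g f \<Longrightarrow> Dom C (Comp C g f) = Dom C f"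
    and cod_comp: "composable C g f \<Longrightarrow> Cod C (Comp C g f) = Cod C g"
    and comp_undef: "\<not> composable C g f \<Longrightarrow> Comp C g f = undefined"
    and comp_ident_right: "f \<in> Arr C \<Longrightarrow> Comp C f (Ident C (Dom C f)) = f"
    and comp_ident_left: "f \<in> Arr C \<Longrightarrow> Comp C (Ident C (Cod C f)) f = f"
    and comp_assoc: "composable C h g \<Longrightarrow> composable C g f \<Longrightarrow>
          Comp C h (Comp C g f) = Comp C (Comp C h g) f"

definition is_iso :: "('o, 'm) cat \<Rightarrow> 'm \<Rightarrow> bool" where
  "is_iso C f \<longleftrightarrow> f \<in> Arr C \<and>
     (\<exists>g. composable C g f \<and> composable C f g \<and>
          Comp C g f = Ident C (Dom C f) \<and> Comp C f g = Ident C (Cod C f))"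

definition is_mono :: "('o, 'm) cat \<Rightarrow> 'm \<Rightarrow> bool" where
  "is_mono C f \<longleftrightarrow> f \<in> Arr C \<and>
     (\<forall>g h. composable C f g \<and> composable C f h \<and> Dom C g = Dom C h \<and>
            Comp C f g = Comp C f h \<longrightarrow> g = h)"

definition is_epi :: "('o, 'm) cat \<Rightarrow> 'm \<Rightarrow> bool" where
  "is_epi C f \<longleftrightarrow> f \<in> Arr C \<and>
     (\<forall>g h. composable C g f \<and> composable C h f \<and> Cod C g = Cod C h \<and>
            Comp C g f = Comp C h f \<longrightarrow> g = h)"

text \<open>Every commutative square \<open>m \<circ> k = l \<circ> e\<close> has a unique diagonal filler.\<close>

definition orthogonal_arrows :: "('o, 'm) cat \<Rightarrow> 'm \<Rightarrow> 'm \<Rightarrow> bool" where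
  "orthogonal_arrows C e m \<longleftrightarrow>
     (\<forall>k l. composable C m k \<and> composable C l e \<and> Comp C m k = Comp C l e \<longrightarrow>
        (\<exists>!d. composable C d e \<and> composable C m d \<and> Comp C d e = k \<and> Comp C m d = l))"

locale orthogonal_factorisation_system = category C
  for C :: "('o, 'm) cat" +
  fixes E M :: "'m set"
  assumes E_arr: "E \<subseteq> Arr C"
    and M_arr: "M \<subseteq> Arr C"
    and iso_E: "is_iso C f \<Longrightarrow> f \<in> E"
    and iso_M: "is_iso C f \<Longrightarrow> f \<in> M"
    and comp_E: "f \<in> E \<Longrightarrow> g \<in> E \<Longrightarrow> composable C g f \<Longrightarrow> Comp C g f \<in> E"
    and comp_M: "f \<in> M \<Longrightarrow> g \<in> M \<Longrightarrow> composable C g f \<Longrightarrow> Comp C g f \<in> M"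
    and factorisation:
      "f \<in> Arr C \<Longrightarrow> \<exists>e\<in>E. \<exists>m\<in>M. composable C m e \<and> Comp C m e = f"
    and orthogonality: "e \<in> E \<Longrightarrow> m \<in> M \<Longrightarrow> orthogonal_arrows C e m"


section \<open>Functors and lenses\<close>

record ('o, 'm, 'p, 'n) cat_functor =
  Src :: "('o, 'm) cat"
  Tgt :: "('p, 'n) cat"
  FObj :: "'o \<Rightarrow> 'p"
  FArr :: "'m \<Rightarrow> 'n"

definition is_functor :: "('o, 'm, 'p, 'n, 'z) cat_functor_scheme \<Rightarrow> bool" where
  "is_functor F \<longleftrightarrow> category (Src F) \<and> category (Tgt F) \<and>
     FObj F \<in> Obj (Src F) \<rightarrow>\<^sub>E Obj (Tgt F) \<and>
     FArr F \<in> Arr (Src F) \<rightarrow>\<^sub>E Arr (Tgt F) \<and>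
     (\<forall>w\<in>Arr (Src F). Dom (Tgt F) (FArr F w) = FObj F (Dom (Src F) w) \<and>
                       Cod (Tgt F) (FArr F w) = FObj F (Cod (Src F) w)) \<and>
     (\<forall>a\<in>Obj (Src F). FArr F (Ident (Src F) a) = Ident (Tgt F) (FObj F a)) \<and>
     (\<forall>w w'. composable (Src F) w' w \<longrightarrow>
        FArr F (Comp (Src F) w' w) = Comp (Tgt F) (FArr F w') (FArr F w))"

definition surjective_on_objects :: "('o, 'm, 'p, 'n, 'z) cat_functor_scheme \<Rightarrow> bool" where
  "surjective_on_objects F \<longleftrightarrow> FObj F ` Obj (Src F) = Obj (Tgt F)"

text \<open>The pairs \<open>(a, u : F a \<rightarrow> b)\<close> to be lifted along \<open>F\<close>.\<close>

definition liftable :: "('o, 'm, 'p, 'n, 'z) cat_functor_scheme \<Rightarrow> 'o \<Rightarrow> 'n \<Rightarrow> bool" where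
  "liftable F a u \<longleftrightarrow> a \<in> Obj (Src F) \<and> u \<in> Arr (Tgt F) \<and> Dom (Tgt F) u = FObj F a"

definition discrete_opfibration :: "('o, 'm, 'p, 'n, 'z) cat_functor_scheme \<Rightarrow> bool" where
  "discrete_opfibration F \<longleftrightarrow> is_functor F \<and>
     (\<forall>a u. liftable F a u \<longrightarrow>
        (\<exists>!w. w \<in> Arr (Src F) \<and> Dom (Src F) w = a \<and> FArr F w = u))"

definition cosieve :: "('o, 'm, 'p, 'n, 'z) cat_functor_scheme \<Rightarrow> bool" where
  "cosieve F \<longleftrightarrow> discrete_opfibration F \<and> inj_on (FObj F) (Obj (Src F))"

record ('o, 'm, 'p, 'n) lens = "('o, 'm, 'p, 'n) cat_functor" +
  Lift :: "'o \<Rightarrow> 'n \<Rightarrow> 'm"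

definition is_lens :: "('o, 'm, 'p, 'n) lens \<Rightarrow> bool" where
  "is_lens f \<longleftrightarrow> is_functor f \<and>
     (\<forall>a u. liftable f a u \<longrightarrow>
        Lift f a u \<in> Arr (Src f) \<and> Dom (Src f) (Lift f a u) = a \<and>
        FArr f (Lift f a u) = u) \<and>
     (\<forall>a\<in>Obj (Src f). Lift f a (Ident (Tgt f) (FObj f a)) = Ident (Src f) a) \<and>
     (\<forall>a u v. liftable f a u \<and> composable (Tgt f) v u \<longrightarrow>
        Lift f a (Comp (Tgt f) v u) =
          Comp (Src f) (Lift f (Cod (Src f) (Lift f a u)) v) (Lift f a u)) \<and>
     (\<forall>a u. \<not> liftable f a u \<longrightarrow> Lift f a u = undefined)"

definition lens_ident :: "('o, 'm) cat \<Rightarrow> ('o, 'm, 'o, 'm) lens" where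
  "lens_ident A =
     \<lparr>Src = A, Tgt = A,
      FObj = (\<lambda>a\<in>Obj A. a),
      FArr = (\<lambda>w\<in>Arr A. w),
      Lift = (\<lambda>a u. if a \<in> Obj A \<and> u \<in> Arr A \<and> Dom A u = a then u else undefined)\<rparr>"

definition lens_comp ::
    "('p, 'n, 'q, 'k) lens \<Rightarrow> ('o, 'm, 'p, 'n) lens \<Rightarrow> ('o, 'm, 'q, 'k) lens" where
  "lens_comp g f =
     \<lparr>Src = Src f, Tgt = Tgt g,
      FObj = (\<lambda>a\<in>Obj (Src f). FObj g (FObj f a)),
      FArr = (\<lambda>w\<in>Arr (Src f). FArr g (FArr f w)),
      Lift = (\<lambda>a u. if a \<in> Obj (Src f) \<and> u \<in> Arr (Tgt g) \<and>
                       Dom (Tgt g) u = FObj g (FObj f a)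
                    then Lift f a (Lift g (FObj f a) u) else undefined)\<rparr>"


section \<open>The category of small categories and lenses\<close>

text \<open>
  The type \<open>'u\<close> plays the role of the universe, and a set is small if it has strictly
  smaller cardinality than \<open>'u\<close>. If \<open>'u\<close> has the cardinality of a Grothendieck universe
  \<open>U\<close>, then up to isomorphism the small categories are those belonging to \<open>U\<close>; if it has
  cardinality \<open>\<kappa>\<^sup>+\<close>, they are the categories with at most \<open>\<kappa>\<close> arrows.
\<close>

definition small_category :: "('u, 'u) cat \<Rightarrow> bool" where
  "small_category A \<longleftrightarrow> category A \<and>
     Obj A \<prec> (UNIV :: 'u set) \<and> Arr A \<prec> (UNIV :: 'u set)"

definition small_lens :: "('u, 'u, 'u, 'u) lens \<Rightarrow> bool" where
  "small_lens f \<longleftrightarrow> is_lens f \<and> small_category (Src f) \<and> small_category (Tgt f)"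

definition Lens :: "(('u, 'u) cat, ('u, 'u, 'u, 'u) lens) cat" where
  "Lens =
     \<lparr>Obj = {A. small_category A},
      Arr = {f. small_lens f},
      Dom = (\<lambda>f\<in>{f. small_lens f}. Src f),
      Cod = (\<lambda>f\<in>{f. small_lens f}. Tgt f),
      Ident = (\<lambda>A\<in>{A. small_category A}. lens_ident A),
      Comp = (\<lambda>g f. if small_lens f \<and> small_lens g \<and> Tgt f = Src g
                    then lens_comp g f else undefined)\<rparr>"

definition surjective_lenses :: "('u, 'u, 'u, 'u) lens set" where
  "surjective_lenses = {f \<in> Arr Lens. surjective_on_objects f}"

definition cosieve_lenses :: "('u, 'u, 'u, 'u) lens set" where
  "cosieve_lenses = {f \<in> Arr Lens. cosieve f}"

end

theory Submission imports Defs begin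

text \<open>
  The image of a lens on objects is closed under outgoing arrows, so the full subcategory on it is
  a cosieve, and this gives the factorisation. A filler of a square from a surjective lens to a
  cosieve is forced on objects and arrows by the cosieve, and lifts as the bottom lens does.

  A mono \<open>f\<close> is compared with the two projections of its kernel pair \<open>A \<times>\<^sub>B A\<close>: these are lenses,
  lifting \<open>w\<close> in one component and \<open>f w\<close> along \<open>f\<close> in the other, and they become equal after
  composition with \<open>f\<close>. Hence \<open>f\<close> is injective on objects and arrows, i.e. a cosieve. An epi
  \<open>f\<close> is compared with the two inclusions of \<open>B\<close> into two copies of \<open>B\<close> glued along the image of
  \<open>f\<close>; they agree after \<open>f\<close>, and differ unless \<open>f\<close> is surjective on objects. Both test categories
  live on other types, but they have fewer than \<open>'u\<close> arrows and objects, so they are isomorphic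
  to small ones.
\<close>

section \<open>Categories, functors and lenses\<close>

context category
begin

lemma dom_in [simp]: "f \<in> Arr C \<Longrightarrow> Dom C f \<in> Obj C"
  using dom_closed by auto

lemma cod_in [simp]: "f \<in> Arr C \<Longrightarrow> Cod C f \<in> Obj C"
  using cod_closed by auto

lemma ident_in [simp]: "x \<in> Obj C \<Longrightarrow> Ident C x \<in> Arr C"
  using ident_closed by auto

lemma
  assumes "f \<in> Arr C" "g \<in> Arr C" "Cod C f = Dom C g"
  shows comp_in: "Comp C g f \<in> Arr C"
    and dom_comp': "Dom C (Comp C g f) = Dom C f"
    and cod_comp': "Cod C (Comp C g f) = Cod C g"
  using assms comp_closed dom_comp cod_comp by (auto simp: composable_def)

lemma comp_assoc':
  assumes "f \<in> Arr C" "g \<in> Arr C" "h \<in> Arr C" "Cod C f = Dom C g" "Cod C g = Dom C h"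
  shows "Comp C h (Comp C g f) = Comp C (Comp C h g) f"
  using assms comp_assoc by (auto simp: composable_def)

text \<open>This and the next three lemmas supply the closure conditions of the factorisation
  system, once its two classes are known to be the epis and the monos.\<close>

lemma iso_imp_mono: "is_iso C f \<Longrightarrow> is_mono C f"
  unfolding is_iso_def is_mono_def composable_def
  by (metis comp_assoc' comp_ident_left)

lemma iso_imp_epi: "is_iso C f \<Longrightarrow> is_epi C f"
  unfolding is_iso_def is_epi_def composable_def
  by (metis comp_assoc' comp_ident_right)

lemma mono_comp:
  assumes "is_mono C f" "is_mono C g" "composable C g f"
  shows "is_mono C (Comp C g f)"
  using assms unfolding is_mono_def composable_def
  by (smt (verit) comp_assoc' comp_in cod_comp' dom_comp')

lemma epi_comp:
  assumes "is_epi C f" "is_epi C g" "composable C g f"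
  shows "is_epi C (Comp C g f)"
  using assms unfolding is_epi_def composable_def
  by (smt (verit) comp_assoc' comp_in cod_comp' dom_comp')

end

section \<open>Rules for functors and lenses\<close>

lemma
  assumes "is_functor F"
  shows functor_src: "category (Src F)"
    and functor_tgt: "category (Tgt F)"
    and functor_obj: "a \<in> Obj (Src F) \<Longrightarrow> FObj F a \<in> Obj (Tgt F)"
    and functor_arr: "w \<in> Arr (Src F) \<Longrightarrow> FArr F w \<in> Arr (Tgt F)"
    and functor_dom: "w \<in> Arr (Src F) \<Longrightarrow> Dom (Tgt F) (FArr F w) = FObj F (Dom (Src F) w)"
    and functor_cod: "w \<in> Arr (Src F) \<Longrightarrow> Cod (Tgt F) (FArr F w) = FObj F (Cod (Src F) w)"
    and functor_ident: "a \<in> Obj (Src F) \<Longrightarrow> FArr F (Ident (Src F) a) = Ident (Tgt F) (FObj F a)"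
    and functor_comp: "w \<in> Arr (Src F) \<Longrightarrow> w' \<in> Arr (Src F) \<Longrightarrow> Cod (Src F) w = Dom (Src F) w' \<Longrightarrow>
        FArr F (Comp (Src F) w' w) = Comp (Tgt F) (FArr F w') (FArr F w)"
    and functor_obj_undef: "a \<notin> Obj (Src F) \<Longrightarrow> FObj F a = undefined"
    and functor_arr_undef: "w \<notin> Arr (Src F) \<Longrightarrow> FArr F w = undefined"
  using assms unfolding is_functor_def composable_def by (auto simp: PiE_def extensional_def)

lemma
  assumes "is_lens f"
  shows lens_functor: "is_functor f"
    and lift_undef: "\<not> (a \<in> Obj (Src f) \<and> u \<in> Arr (Tgt f) \<and> Dom (Tgt f) u = FObj f a) \<Longrightarrow>
        Lift f a u = undefined"
  using assms unfolding is_lens_def liftable_def by auto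

lemma
  assumes "is_lens f" "a \<in> Obj (Src f)" "u \<in> Arr (Tgt f)" "Dom (Tgt f) u = FObj f a"
  shows lift_arr: "Lift f a u \<in> Arr (Src f)"
    and lift_dom: "Dom (Src f) (Lift f a u) = a"
    and functor_lift: "FArr f (Lift f a u) = u"
    and functor_cod_lift: "FObj f (Cod (Src f) (Lift f a u)) = Cod (Tgt f) u"
proof -
  show *: "Lift f a u \<in> Arr (Src f)" "Dom (Src f) (Lift f a u) = a" "FArr f (Lift f a u) = u"
    using assms unfolding is_lens_def liftable_def by auto
  show "FObj f (Cod (Src f) (Lift f a u)) = Cod (Tgt f) u"
    using functor_cod[OF lens_functor[OF assms(1)] *(1)] * by simp
qed

lemma
  assumes "is_lens f" "a \<in> Obj (Src f)"
  shows lift_ident: "Lift f a (Ident (Tgt f) (FObj f a)) = Ident (Src f) a"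
    and lift_comp: "u \<in> Arr (Tgt f) \<Longrightarrow> Dom (Tgt f) u = FObj f a \<Longrightarrow> v \<in> Arr (Tgt f) \<Longrightarrow>
        Cod (Tgt f) u = Dom (Tgt f) v \<Longrightarrow>
        Lift f a (Comp (Tgt f) v u) =
          Comp (Src f) (Lift f (Cod (Src f) (Lift f a u)) v) (Lift f a u)"
  using assms unfolding is_lens_def liftable_def composable_def by auto

lemmas functor_facts = functor_src functor_tgt functor_obj functor_arr functor_dom functor_cod
  functor_ident functor_comp

lemmas category_facts = category.dom_in category.cod_in category.ident_in category.comp_in
  category.dom_comp' category.cod_comp' category.dom_ident category.cod_ident
  category.comp_ident_left category.comp_ident_right

lemmas lens_facts = lift_arr lift_dom functor_lift functor_cod_lift lift_ident

lemma is_functorI: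
  assumes "category (Src F)" "category (Tgt F)"
    and "FObj F \<in> extensional (Obj (Src F))" "FArr F \<in> extensional (Arr (Src F))"
    and "\<And>a. a \<in> Obj (Src F) \<Longrightarrow> FObj F a \<in> Obj (Tgt F)"
    and "\<And>w. w \<in> Arr (Src F) \<Longrightarrow> FArr F w \<in> Arr (Tgt F)"
    and "\<And>w. w \<in> Arr (Src F) \<Longrightarrow> Dom (Tgt F) (FArr F w) = FObj F (Dom (Src F) w)"
    and "\<And>w. w \<in> Arr (Src F) \<Longrightarrow> Cod (Tgt F) (FArr F w) = FObj F (Cod (Src F) w)"
    and "\<And>a. a \<in> Obj (Src F) \<Longrightarrow> FArr F (Ident (Src F) a) = Ident (Tgt F) (FObj F a)"
    and "\<And>w w'. w \<in> Arr (Src F) \<Longrightarrow> w' \<in> Arr (Src F) \<Longrightarrow> Cod (Src F) w = Dom (Src F) w' \<Longrightarrow>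
        FArr F (Comp (Src F) w' w) = Comp (Tgt F) (FArr F w') (FArr F w)"
  shows "is_functor F"
  using assms unfolding is_functor_def composable_def by (auto simp: PiE_def)

lemma is_lensI:
  assumes "is_functor f"
    and "\<And>a u. a \<in> Obj (Src f) \<Longrightarrow> u \<in> Arr (Tgt f) \<Longrightarrow> Dom (Tgt f) u = FObj f a \<Longrightarrow>
        Lift f a u \<in> Arr (Src f) \<and> Dom (Src f) (Lift f a u) = a \<and> FArr f (Lift f a u) = u"
    and "\<And>a. a \<in> Obj (Src f) \<Longrightarrow> Lift f a (Ident (Tgt f) (FObj f a)) = Ident (Src f) a"
    and "\<And>a u v. a \<in> Obj (Src f) \<Longrightarrow> u \<in> Arr (Tgt f) \<Longrightarrow> Dom (Tgt f) u = FObj f a \<Longrightarrow>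
        v \<in> Arr (Tgt f) \<Longrightarrow> Cod (Tgt f) u = Dom (Tgt f) v \<Longrightarrow>
        Lift f a (Comp (Tgt f) v u) =
          Comp (Src f) (Lift f (Cod (Src f) (Lift f a u)) v) (Lift f a u)"
    and "\<And>a u. \<not> (a \<in> Obj (Src f) \<and> u \<in> Arr (Tgt f) \<and> Dom (Tgt f) u = FObj f a) \<Longrightarrow>
        Lift f a u = undefined"
  shows "is_lens f"
  unfolding is_lens_def liftable_def composable_def using assms by blast

lemma lens_eqI:
  fixes f g :: "('o, 'm, 'p, 'n) lens"
  assumes f: "is_lens f" and g: "is_lens g" and S: "Src f = Src g" and T: "Tgt f = Tgt g"
    and o: "\<And>a. a \<in> Obj (Src g) \<Longrightarrow> FObj f a = FObj g a"
    and a: "\<And>w. w \<in> Arr (Src g) \<Longrightarrow> FArr f w = FArr g w"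
    and l: "\<And>a u. a \<in> Obj (Src g) \<Longrightarrow> u \<in> Arr (Tgt g) \<Longrightarrow> Dom (Tgt g) u = FObj g a \<Longrightarrow>
      Lift f a u = Lift g a u"
  shows "f = g"
proof (rule lens.equality)
  have FO: "FObj f a = FObj g a" for a
    using o S functor_obj_undef[OF lens_functor[OF f]] functor_obj_undef[OF lens_functor[OF g]]
    by (cases "a \<in> Obj (Src g)") auto
  then show "FObj f = FObj g" by blast
  have "FArr f w = FArr g w" for w
    using a S functor_arr_undef[OF lens_functor[OF f]] functor_arr_undef[OF lens_functor[OF g]]
    by (cases "w \<in> Arr (Src g)") auto
  then show "FArr f = FArr g" by blast
  have "Lift f a u = Lift g a u" for a u
    using l[of a u] S T FO lift_undef[OF f] lift_undef[OF g]
    by (cases "a \<in> Obj (Src g) \<and> u \<in> Arr (Tgt g) \<and> Dom (Tgt g) u = FObj g a") auto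
  then show "Lift f = Lift g" by blast
qed (use S T in auto)

section \<open>Identities and composites of lenses\<close>

lemma lens_comp_simps [simp]:
  "Src (lens_comp g f) = Src f" "Tgt (lens_comp g f) = Tgt g"
  "a \<in> Obj (Src f) \<Longrightarrow> FObj (lens_comp g f) a = FObj g (FObj f a)"
  "w \<in> Arr (Src f) \<Longrightarrow> FArr (lens_comp g f) w = FArr g (FArr f w)"
  "a \<in> Obj (Src f) \<Longrightarrow> u \<in> Arr (Tgt g) \<Longrightarrow> Dom (Tgt g) u = FObj g (FObj f a) \<Longrightarrow>
     Lift (lens_comp g f) a u = Lift f a (Lift g (FObj f a) u)"
  by (auto simp: lens_comp_def)

lemma lens_ident_simps [simp]:
  "Src (lens_ident A) = A" "Tgt (lens_ident A) = A"
  "a \<in> Obj A \<Longrightarrow> FObj (lens_ident A) a = a"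
  "w \<in> Arr A \<Longrightarrow> FArr (lens_ident A) w = w"
  "a \<in> Obj A \<Longrightarrow> u \<in> Arr A \<Longrightarrow> Dom A u = a \<Longrightarrow> Lift (lens_ident A) a u = u"
  by (auto simp: lens_ident_def)

lemma is_lens_ident:
  assumes "category A"
  shows "is_lens (lens_ident A)"
proof (rule is_lensI)
  show "is_functor (lens_ident A)"
    by (rule is_functorI) (use assms in \<open>auto simp: category_facts lens_ident_def\<close>)
qed (use assms in \<open>auto simp: category_facts lens_ident_def\<close>)

lemma is_lens_comp:
  assumes f: "is_lens f" and g: "is_lens g" and fg: "Tgt f = Src g"
  shows "is_lens (lens_comp g f)"
proof -
  note F = lens_functor[OF f] and G = lens_functor[OF g]
  note [simp] = functor_facts[OF F, unfolded fg] functor_facts[OF G]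
    lens_facts[OF f, unfolded fg] lens_facts[OF g]
    category_facts[OF functor_src[OF F]] category_facts[OF functor_tgt[OF F, unfolded fg]]
    category_facts[OF functor_tgt[OF G]]
  show ?thesis
  proof (rule is_lensI)
    show "is_functor (lens_comp g f)"
      by (rule is_functorI) (auto simp: lens_comp_def)
  next
    fix a u v
    assume "a \<in> Obj (Src (lens_comp g f))" "u \<in> Arr (Tgt (lens_comp g f))"
      "Dom (Tgt (lens_comp g f)) u = FObj (lens_comp g f) a"
      "v \<in> Arr (Tgt (lens_comp g f))" "Cod (Tgt (lens_comp g f)) u = Dom (Tgt (lens_comp g f)) v"
    then show "Lift (lens_comp g f) a (Comp (Tgt (lens_comp g f)) v u) =
          Comp (Src (lens_comp g f)) (Lift (lens_comp g f)
            (Cod (Src (lens_comp g f)) (Lift (lens_comp g f) a u)) v) (Lift (lens_comp g f) a u)"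
      by (auto simp: lift_comp[OF f, unfolded fg] lift_comp[OF g])
  qed (auto simp: lens_comp_def)
qed

lemma lens_comp_assoc:
  assumes f: "is_lens f" and g: "is_lens g" and h: "is_lens h"
    and fg: "Tgt f = Src g" and gh: "Tgt g = Src h"
  shows "lens_comp h (lens_comp g f) = lens_comp (lens_comp h g) f"
proof -
  note F = lens_functor[OF f] and G = lens_functor[OF g] and H = lens_functor[OF h]
  note [simp] = functor_facts[OF F, unfolded fg] functor_facts[OF G, unfolded gh]
    lens_facts[OF f, unfolded fg] lens_facts[OF g, unfolded gh] lens_facts[OF h] fg gh
  show ?thesis
    by (rule lens_eqI) (use assms in \<open>auto intro!: is_lens_comp\<close>)
qed

lemma lens_comp_ident_right:
  assumes "is_lens f"
  shows "lens_comp f (lens_ident (Src f)) = f"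
proof -
  have "category (Src f)" using assms functor_src lens_functor by blast
  with assms show ?thesis
    by (intro lens_eqI is_lens_comp is_lens_ident) (auto simp: lens_facts)
qed

lemma lens_comp_ident_left:
  assumes "is_lens f"
  shows "lens_comp (lens_ident (Tgt f)) f = f"
proof -
  have "category (Tgt f)" using assms functor_tgt lens_functor by blast
  with assms show ?thesis
    by (intro lens_eqI is_lens_comp is_lens_ident) (auto simp: functor_facts lens_functor)
qed

section \<open>The category of small categories and lenses\<close>

lemma Lens_simps [simp]:
  "A \<in> Obj Lens \<longleftrightarrow> small_category A"
  "f \<in> Arr Lens \<longleftrightarrow> small_lens f"
  "small_lens f \<Longrightarrow> Dom Lens f = Src f"
  "small_lens f \<Longrightarrow> Cod Lens f = Tgt f"
  "small_category A \<Longrightarrow> Ident Lens A = lens_ident A"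
  "small_lens f \<Longrightarrow> small_lens g \<Longrightarrow> Tgt f = Src g \<Longrightarrow> Comp Lens g f = lens_comp g f"
  by (auto simp: Lens_def)

lemma composable_Lens:
  "composable Lens g f \<longleftrightarrow> small_lens f \<and> small_lens g \<and> Tgt f = Src g"
  by (auto simp: composable_def)

lemma small_lensD:
  "small_lens f \<Longrightarrow> is_lens f"
  "small_lens f \<Longrightarrow> small_category (Src f)"
  "small_lens f \<Longrightarrow> small_category (Tgt f)"
  by (auto simp: small_lens_def)

lemma small_lens_comp:
  "small_lens f \<Longrightarrow> small_lens g \<Longrightarrow> Tgt f = Src g \<Longrightarrow> small_lens (lens_comp g f)"
  by (simp add: small_lens_def is_lens_comp)

lemma small_lens_ident: "small_category A \<Longrightarrow> small_lens (lens_ident A)"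
  by (simp add: small_lens_def small_category_def is_lens_ident)

lemma lens_category: "category Lens"
\<comment> \<open>Cases 1, 2, 3 and 9 also concern values off the domains of definition, which only
  the definition of \<open>Lens\<close> gives.\<close>
proof (unfold_locales, goal_cases)
  case 1
  then show ?case by (auto simp: Lens_def small_lens_def)
next
  case 2
  then show ?case by (auto simp: Lens_def small_lens_def)
next
  case 3
  then show ?case by (auto simp: Lens_def small_lens_ident)
next
  case (9 g f)
  then show ?case by (auto simp: composable_Lens) (auto simp: Lens_def)
qed (auto simp: composable_Lens small_lensD small_lens_comp small_lens_ident
      lens_comp_ident_left lens_comp_ident_right lens_comp_assoc)


section \<open>Cancellation\<close>

lemma
  assumes "cosieve m"
  shows cosieve_functor: "is_functor m"
    and cosieve_obj_inj: "a \<in> Obj (Src m) \<Longrightarrow> a' \<in> Obj (Src m) \<Longrightarrow> FObj m a = FObj m a' \<Longrightarrow> a = a'"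
  using assms by (auto simp: cosieve_def discrete_opfibration_def inj_on_def)

text \<open>Injectivity on objects gives both arrows the same domain; there they lift the same
  arrow, and such a lift is unique.\<close>

lemma cosieve_arr_inj:
  assumes m: "cosieve m" and w: "w \<in> Arr (Src m)" "w' \<in> Arr (Src m)" and eq: "FArr m w = FArr m w'"
  shows "w = w'"
proof -
  note M = cosieve_functor[OF m]
  note [simp] = functor_facts[OF M] category_facts[OF functor_src[OF M]]
  have "FObj m (Dom (Src m) w) = FObj m (Dom (Src m) w')"
    using functor_dom[OF M w(1)] functor_dom[OF M w(2)] eq by simp
  then have d: "Dom (Src m) w = Dom (Src m) w'"
    using cosieve_obj_inj[OF m] w by simp
  have "liftable m (Dom (Src m) w) (FArr m w)" using w by (simp add: liftable_def)
  then show ?thesis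
    using m w eq d unfolding cosieve_def discrete_opfibration_def by metis
qed

lemma cosieve_lift:
  assumes m: "cosieve m" "is_lens m" and "w \<in> Arr (Src m)" "a = Dom (Src m) w"
  shows "Lift m a (FArr m w) = w"
proof -
  note M = cosieve_functor[OF m(1)]
  note [simp] = functor_facts[OF M] category_facts[OF functor_src[OF M]] lens_facts[OF m(2)]
  show ?thesis by (rule cosieve_arr_inj[OF m(1)]) (use assms(3-) in auto)
qed

lemma lens_comp_eqD:
  assumes eq: "lens_comp g f = lens_comp g' f'" and S: "Src f' = Src f"
  shows "a \<in> Obj (Src f) \<Longrightarrow> FObj g (FObj f a) = FObj g' (FObj f' a)"
    and "w \<in> Arr (Src f) \<Longrightarrow> FArr g (FArr f w) = FArr g' (FArr f' w)"
    and "a \<in> Obj (Src f) \<Longrightarrow> u \<in> Arr (Tgt g) \<Longrightarrow> Dom (Tgt g) u = FObj g (FObj f a) \<Longrightarrow>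
     Lift f a (Lift g (FObj f a) u) = Lift f' a (Lift g' (FObj f' a) u)"
proof -
  show o: "FObj g (FObj f a) = FObj g' (FObj f' a)" if "a \<in> Obj (Src f)" for a
    using arg_cong[OF eq, of "\<lambda>k. FObj k a"] that S by simp
  show "FArr g (FArr f w) = FArr g' (FArr f' w)" if "w \<in> Arr (Src f)"
    using arg_cong[OF eq, of "\<lambda>k. FArr k w"] that S by simp
  have "Tgt g' = Tgt g"
    using arg_cong[OF eq, of Tgt] by simp
  then show "Lift f a (Lift g (FObj f a) u) = Lift f' a (Lift g' (FObj f' a) u)"
    if "a \<in> Obj (Src f)" "u \<in> Arr (Tgt g)" "Dom (Tgt g) u = FObj g (FObj f a)"
    using arg_cong[OF eq, of "\<lambda>k. Lift k a u"] that S o by simp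
qed

text \<open>Functor parts agree by injectivity of \<open>m\<close>. For lifts, an arrow
  \<open>u\<close> of \<open>Src m\<close> is itself the lift along \<open>m\<close> of its image,
  so the composites lift that image as \<open>g\<close> and \<open>h\<close> lift \<open>u\<close>.
  The types are arbitrary, so that the lemma also applies to test categories outside
  \<open>Lens\<close>.\<close>

lemma cosieve_cancel:
  assumes m: "is_lens m" "cosieve m" and g: "is_lens g" "Tgt g = Src m" and h: "is_lens h" "Tgt h = Src m"
    and S: "Src g = Src h" and eq: "lens_comp m g = lens_comp m h"
  shows "g = h"
proof -
  note M = lens_functor[OF m(1)] and G = lens_functor[OF g(1)] and H = lens_functor[OF h(1)]
  note [simp] = functor_facts[OF G, unfolded g S] functor_facts[OF H, unfolded h]
    lens_facts[OF g(1), unfolded g S] lens_facts[OF h(1), unfolded h] functor_facts[OF M]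
    category_facts[OF functor_src[OF M]]
  have *: "FObj g a = FObj h a" if "a \<in> Obj (Src h)" for a
    by (rule cosieve_obj_inj[OF m(2)]) (use lens_comp_eqD(1)[OF eq] that S in auto)
  show ?thesis
  proof (rule lens_eqI[OF g(1) h(1)])
    fix a u assume a: "a \<in> Obj (Src h)" "u \<in> Arr (Tgt h)" "Dom (Tgt h) u = FObj h a"
    with h(2) have "Lift g a (Lift m (FObj g a) (FArr m u)) = Lift h a (Lift m (FObj h a) (FArr m u))"
      by (intro lens_comp_eqD(3)[OF eq]) (auto simp: * S)
    then show "Lift g a u = Lift h a u"
      using a h(2) by (simp add: * cosieve_lift[OF m(2,1)])
  next
    show "FArr g w = FArr h w" if "w \<in> Arr (Src h)" for w
      by (rule cosieve_arr_inj[OF m(2)]) (use lens_comp_eqD(2)[OF eq] that S in auto)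
  qed (use * S g h in auto)
qed

lemma surjective_on_objectsE:
  assumes "surjective_on_objects e" "b \<in> Obj (Tgt e)"
  obtains a where "a \<in> Obj (Src e)" "b = FObj e a"
  using assms unfolding surjective_on_objects_def by blast

text \<open>A lens that is surjective on objects is surjective on arrows: each arrow is the image of
  its lift at a preimage of its domain. So the functor parts agree.\<close>

lemma surjective_cancel:
  assumes e: "is_lens e" "surjective_on_objects e"
    and g: "is_lens g" "Src g = Tgt e" and h: "is_lens h" "Src h = Tgt e"
    and T: "Tgt g = Tgt h" and eq: "lens_comp g e = lens_comp h e"
  shows "g = h"
proof -
  note E = lens_functor[OF e(1)] and G = lens_functor[OF g(1)] and H = lens_functor[OF h(1)]
  note [simp] = functor_facts[OF G, unfolded g T] functor_facts[OF H, unfolded h]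
    lens_facts[OF g(1), unfolded g T] lens_facts[OF h(1), unfolded h] functor_facts[OF E]
    category_facts[OF functor_tgt[OF E]] lens_facts[OF e(1)]
  note eqs = lens_comp_eqD[OF eq refl]
  have *: "FObj g b = FObj h b" if "b \<in> Obj (Tgt e)" for b
    using surjective_on_objectsE[OF e(2) that] eqs(1) by metis
  show ?thesis
  proof (rule lens_eqI[OF g(1) h(1)])
    fix b u assume b: "b \<in> Obj (Src h)" "u \<in> Arr (Tgt h)" "Dom (Tgt h) u = FObj h b"
    then obtain a where a: "a \<in> Obj (Src e)" "b = FObj e a"
      using surjective_on_objectsE[OF e(2)] h by metis
    then have "Lift e a (Lift g b u) = Lift e a (Lift h b u)"
      using eqs(3)[of a u] b h T * by auto
    \<comment> \<open>Applying \<open>e\<close> undoes the outer lifting and leaves the lifts along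
      \<open>g\<close> and \<open>h\<close>.\<close>
    then have "FArr e (Lift e a (Lift g b u)) = FArr e (Lift e a (Lift h b u))"
      by simp
    then show "Lift g b u = Lift h b u"
      using a b h * by simp
  next
    fix w assume w: "w \<in> Arr (Src h)"
    with h obtain a where a: "a \<in> Obj (Src e)" "Dom (Tgt e) w = FObj e a"
      using surjective_on_objectsE[OF e(2), of "Dom (Tgt e) w"] by auto
    then show "FArr g w = FArr h w"
      using eqs(2)[of "Lift e a w"] w h by simp
  qed (use * T g h in auto)
qed

section \<open>Factorisation and diagonal fillers\<close>

definition restrict_objects :: "('o, 'm) cat \<Rightarrow> 'o set \<Rightarrow> ('o, 'm) cat" where
  "restrict_objects C S =
     (let W = {w \<in> Arr C. Dom C w \<in> S \<and> Cod C w \<in> S} in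
     \<lparr>Obj = S, Arr = W, Dom = restrict (Dom C) W, Cod = restrict (Cod C) W,
      Ident = restrict (Ident C) S,
      Comp = (\<lambda>v w. if w \<in> W \<and> v \<in> W \<and> Cod C w = Dom C v then Comp C v w else undefined)\<rparr>)"

lemma restrict_objects_simps [simp]:
  "Obj (restrict_objects C S) = S"
  "w \<in> Arr (restrict_objects C S) \<longleftrightarrow> w \<in> Arr C \<and> Dom C w \<in> S \<and> Cod C w \<in> S"
  "w \<in> Arr C \<Longrightarrow> Dom C w \<in> S \<Longrightarrow> Cod C w \<in> S \<Longrightarrow> Dom (restrict_objects C S) w = Dom C w"
  "w \<in> Arr C \<Longrightarrow> Dom C w \<in> S \<Longrightarrow> Cod C w \<in> S \<Longrightarrow> Cod (restrict_objects C S) w = Cod C w"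
  "x \<in> S \<Longrightarrow> Ident (restrict_objects C S) x = Ident C x"
  "w \<in> Arr C \<Longrightarrow> Dom C w \<in> S \<Longrightarrow> Cod C w \<in> S \<Longrightarrow> v \<in> Arr C \<Longrightarrow> Dom C v \<in> S \<Longrightarrow> Cod C v \<in> S \<Longrightarrow>
     Cod C w = Dom C v \<Longrightarrow> Comp (restrict_objects C S) v w = Comp C v w"
  by (auto simp: restrict_objects_def Let_def)

lemma category_restrict_objects:
  assumes C: "category C" and S: "S \<subseteq> Obj C"
  shows "category (restrict_objects C S)"
proof -
  note [simp] = category_facts[OF C] subsetD[OF S]
  show ?thesis
  proof (unfold_locales, goal_cases)
    case (9 g f)
    then show ?case by (auto simp: composable_def restrict_objects_def Let_def)
  next
    case (12 h g f)
    then show ?case using category.comp_assoc'[OF C, of f g h] by (auto simp: composable_def)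
  qed (auto simp: composable_def, (auto simp: restrict_objects_def Let_def)?)
qed

text \<open>A discrete opfibration lifts arrows uniquely, so the \<open>THE\<close> below is well defined on
  liftable pairs.\<close>

definition opfibration_lens :: "('o, 'm, 'p, 'n) cat_functor \<Rightarrow> ('o, 'm, 'p, 'n) lens" where
  "opfibration_lens F =
     \<lparr>Src = Src F, Tgt = Tgt F, FObj = FObj F, FArr = FArr F,
      Lift = (\<lambda>a u. if liftable F a u
        then THE w. w \<in> Arr (Src F) \<and> Dom (Src F) w = a \<and> FArr F w = u else undefined)\<rparr>"

lemma opfibration_lens_simps [simp]:
  "Src (opfibration_lens F) = Src F" "Tgt (opfibration_lens F) = Tgt F"
  "FObj (opfibration_lens F) = FObj F" "FArr (opfibration_lens F) = FArr F"
  by (auto simp: opfibration_lens_def)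

lemma opfibration_lens_Lift:
  assumes F: "discrete_opfibration F" and w: "w \<in> Arr (Src F)" "Dom (Src F) w = a" "FArr F w = u"
  shows "Lift (opfibration_lens F) a u = w"
proof -
  have F': "is_functor F" using F by (auto simp: discrete_opfibration_def)
  note [simp] = functor_facts[OF F'] category_facts[OF functor_src[OF F']]
  have "liftable F a u" using w by (auto simp: liftable_def)
  then show ?thesis
    using F w unfolding opfibration_lens_def discrete_opfibration_def by (auto intro!: the1_equality)
qed

text \<open>The lens laws follow from uniqueness of lifts: an identity lifts an identity, and a
  composite of lifts lifts the composite.\<close>

lemma is_lens_opfibration_lens:
  assumes F: "discrete_opfibration F"
  shows "is_lens (opfibration_lens F)"
proof -
  have F': "is_functor F" using F by (auto simp: discrete_opfibration_def)
  note [simp] = functor_facts[OF F'] category_facts[OF functor_src[OF F']]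
  have lift: "\<exists>w. w \<in> Arr (Src F) \<and> Dom (Src F) w = a \<and> FArr F w = u"
    if "a \<in> Obj (Src F)" "u \<in> Arr (Tgt F)" "Dom (Tgt F) u = FObj F a" for a u
    using F that unfolding discrete_opfibration_def liftable_def by blast
  show ?thesis
  proof (rule is_lensI)
    show "is_functor (opfibration_lens F)"
      using F' by (simp add: is_functor_def)
  next
    fix a u
    assume a: "a \<in> Obj (Src (opfibration_lens F))" "u \<in> Arr (Tgt (opfibration_lens F))"
      "Dom (Tgt (opfibration_lens F)) u = FObj (opfibration_lens F) a"
    with lift obtain w where w: "w \<in> Arr (Src F)" "Dom (Src F) w = a" "FArr F w = u"
      by auto
    with opfibration_lens_Lift[OF F w]
    show "Lift (opfibration_lens F) a u \<in> Arr (Src (opfibration_lens F)) \<and>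
       Dom (Src (opfibration_lens F)) (Lift (opfibration_lens F) a u) = a \<and>
       FArr (opfibration_lens F) (Lift (opfibration_lens F) a u) = u"
      by simp
    fix v
    assume v: "v \<in> Arr (Tgt (opfibration_lens F))"
      "Cod (Tgt (opfibration_lens F)) u = Dom (Tgt (opfibration_lens F)) v"
    then obtain w' where w': "w' \<in> Arr (Src F)" "Dom (Src F) w' = Cod (Src F) w" "FArr F w' = v"
      using lift[of "Cod (Src F) w" v] w by auto
    show "Lift (opfibration_lens F) a (Comp (Tgt (opfibration_lens F)) v u) =
       Comp (Src (opfibration_lens F)) (Lift (opfibration_lens F)
         (Cod (Src (opfibration_lens F)) (Lift (opfibration_lens F) a u)) v) (Lift (opfibration_lens F) a u)"
      using w w' by (simp add: opfibration_lens_Lift[OF F])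
  qed (auto simp: opfibration_lens_Lift[OF F], auto simp: opfibration_lens_def liftable_def)
qed

lemma cosieve_opfibration_lens [simp]: "cosieve (opfibration_lens F) \<longleftrightarrow> cosieve F"
  by (simp add: cosieve_def discrete_opfibration_def is_functor_def liftable_def)

text \<open>Injectivity on all arrows gives uniqueness of lifts; every discrete opfibration built
  below has it.\<close>

lemma discrete_opfibrationI:
  assumes "is_functor F"
    and "\<And>a u. a \<in> Obj (Src F) \<Longrightarrow> u \<in> Arr (Tgt F) \<Longrightarrow> Dom (Tgt F) u = FObj F a \<Longrightarrow>
      \<exists>w. w \<in> Arr (Src F) \<and> Dom (Src F) w = a \<and> FArr F w = u"
    and "inj_on (FArr F) (Arr (Src F))"
  shows "discrete_opfibration F"
  using assms unfolding discrete_opfibration_def liftable_def inj_on_def by metis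

text \<open>The codomain of \<open>u\<close> is the image of the codomain of a lift of
  \<open>u\<close>.\<close>

lemma lens_image_closed:
  assumes f: "is_lens f" and u: "u \<in> Arr (Tgt f)" "Dom (Tgt f) u \<in> FObj f ` Obj (Src f)"
  shows "Cod (Tgt f) u \<in> FObj f ` Obj (Src f)"
proof -
  note F = lens_functor[OF f]
  obtain a where a: "a \<in> Obj (Src f)" "Dom (Tgt f) u = FObj f a" using u(2) by auto
  have "FObj f (Cod (Src f) (Lift f a u)) \<in> FObj f ` Obj (Src f)"
    by (intro imageI category.cod_in[OF functor_src[OF F]] lift_arr[OF f a(1) u(1) a(2)])
  then show ?thesis using functor_cod_lift[OF f a(1) u(1) a(2)] by simp
qed

text \<open>The last two inclusions let smallness pass from \<open>Tgt f\<close> to the middle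
  category.\<close>

lemma factorisation_exists:
  fixes f :: "('o, 'm, 'p, 'n) lens"
  assumes f: "is_lens f"
  obtains e :: "('o, 'm, 'p, 'n) lens" and m :: "('p, 'n, 'p, 'n) lens"
  where "is_lens e" "surjective_on_objects e" "is_lens m" "cosieve m" "lens_comp m e = f"
    "Src e = Src f" "Tgt m = Tgt f" "Tgt e = Src m"
    "Obj (Src m) \<subseteq> Obj (Tgt f)" "Arr (Src m) \<subseteq> Arr (Tgt f)"
proof -
  note F = lens_functor[OF f]
  note [simp] = functor_facts[OF F] category_facts[OF functor_src[OF F]] lens_facts[OF f]
    category_facts[OF functor_tgt[OF F]]
  define S where "S = FObj f ` Obj (Src f)"
  define I where "I = restrict_objects (Tgt f) S"
  note up = lens_image_closed[OF f, folded S_def]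
  have inS [simp]: "FObj f a \<in> S" if "a \<in> Obj (Src f)" for a using that by (auto simp: S_def)
  have sub: "S \<subseteq> Obj (Tgt f)" by (auto simp: S_def)
  then have I [simp]: "category I"
    unfolding I_def by (intro category_restrict_objects) auto
  \<comment> \<open>Only the target shrinks. The liftable pairs stay the same, since an arrow that
    starts in the image also ends there.\<close>
  define e where "e = f\<lparr>Tgt := I\<rparr>"
  have e_simps [simp]: "Src e = Src f" "Tgt e = I" "FObj e = FObj f" "FArr e = FArr f"
    "Lift e = Lift f"
    by (auto simp: e_def)
  have fun_e: "is_functor e"
    by (rule is_functorI) (use I functor_obj_undef[OF F] functor_arr_undef[OF F] in
      \<open>auto simp: I_def extensional_def\<close>)
  have lens_e: "is_lens e"
  proof (rule is_lensI[OF fun_e])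
    fix a u assume "\<not> (a \<in> Obj (Src e) \<and> u \<in> Arr (Tgt e) \<and> Dom (Tgt e) u = FObj e a)"
    \<comment> \<open>By \<open>up\<close>, a pair that is not liftable along \<open>e\<close> is
      not liftable along \<open>f\<close> either.\<close>
    with up[of u] show "Lift e a u = undefined"
      by (intro trans[OF _ lift_undef[OF f, of a u]]) (auto simp: I_def)
  qed (auto simp: lift_comp[OF f] I_def)
  define i where "i = \<lparr>Src = I, Tgt = Tgt f, FObj = (\<lambda>x\<in>Obj I. x), FArr = (\<lambda>w\<in>Arr I. w)\<rparr>"
  have i_simps [simp]: "Src i = I" "Tgt i = Tgt f" "FObj i = (\<lambda>x\<in>Obj I. x)"
    "FArr i = (\<lambda>w\<in>Arr I. w)"
    by (auto simp: i_def)
  have fun_i: "is_functor i"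
    by (rule is_functorI) (use I sub in \<open>auto simp: I_def subset_iff\<close>)
  have opf_i: "discrete_opfibration i"
    by (rule discrete_opfibrationI[OF fun_i]) (use up in \<open>auto simp: I_def inj_on_def\<close>)
  then have cos_i: "cosieve i" by (auto simp: cosieve_def inj_on_def)
  define m where "m = opfibration_lens i"
  note m_Lift = opfibration_lens_Lift[OF opf_i, folded m_def]
  have m_simps [simp]: "Src m = I" "Tgt m = Tgt f" "FObj m = (\<lambda>x\<in>Obj I. x)"
    "FArr m = (\<lambda>w\<in>Arr I. w)"
    by (auto simp: m_def)
  have lens_m: "is_lens m"
    unfolding m_def using opf_i by (rule is_lens_opfibration_lens)
  have comp: "lens_comp m e = f"
  proof (rule lens_eqI[OF is_lens_comp[OF lens_e lens_m] f])
    fix a u assume a: "a \<in> Obj (Src f)" "u \<in> Arr (Tgt f)" "Dom (Tgt f) u = FObj f a"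
    \<comment> \<open>The inclusion lifts an arrow to itself, so the composite lifts as
      \<open>f\<close> does.\<close>
    have "Lift m (FObj f a) u = u"
      by (rule m_Lift) (use a up[of u] in \<open>auto simp: I_def\<close>)
    then show "Lift (lens_comp m e) a u = Lift f a u" using a by (simp add: I_def)
  qed (auto simp: I_def)
  have surj: "surjective_on_objects e"
    by (simp add: surjective_on_objects_def I_def S_def)
  have "cosieve m"
    using cos_i by (simp add: m_def)
  moreover have "Obj I \<subseteq> Obj (Tgt f)" "Arr I \<subseteq> Arr (Tgt f)"
    using sub by (auto simp: I_def)
  ultimately show ?thesis
    by (intro that[OF lens_e surj lens_m _ comp]) simp_all
qed

text \<open>Surjectivity of \<open>e\<close> puts the image of \<open>l\<close> inside that of
  \<open>m\<close>, and injectivity of \<open>m\<close> makes the resulting factor of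
  \<open>l\<close> through \<open>m\<close> unique; all laws are then checked after applying
  \<open>m\<close>.\<close>

lemma filler_exists:
  assumes e: "is_lens e" "surjective_on_objects e" and m: "is_lens m" "cosieve m"
    and k: "is_lens k" "Src k = Src e" "Tgt k = Src m"
    and l: "is_lens l" "Src l = Tgt e" "Tgt l = Tgt m"
    and eq: "lens_comp m k = lens_comp l e"
  obtains d where "is_lens d" "Src d = Tgt e" "Tgt d = Src m" "lens_comp d e = k" "lens_comp m d = l"
proof -
  note E = lens_functor[OF e(1)] and M = lens_functor[OF m(1)]
    and K = lens_functor[OF k(1)] and L = lens_functor[OF l(1)]
  note [simp] = k(2-) l(2-) functor_facts[OF E] lens_facts[OF e(1)]
    functor_facts[OF M] lens_facts[OF m(1)]
    functor_facts[OF K, unfolded k] lens_facts[OF k(1), unfolded k]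
    functor_facts[OF L, unfolded l] lens_facts[OF l(1), unfolded l]
    category_facts[OF functor_src[OF E]] category_facts[OF functor_tgt[OF E]]
    category_facts[OF functor_src[OF M]] category_facts[OF functor_tgt[OF M]]
  note eqs = lens_comp_eqD[OF eq k(2)[symmetric], simplified]
  note lift_m [simp] = cosieve_lift[OF m(2,1)]
  define D where "D b = (THE c. c \<in> Obj (Src m) \<and> FObj m c = FObj l b)" for b
  have D: "D b \<in> Obj (Src m) \<and> FObj m (D b) = FObj l b" if b: "b \<in> Obj (Tgt e)" for b
  proof -
    obtain a where "a \<in> Obj (Src e)" "b = FObj e a"
      using surjective_on_objectsE[OF e(2) b] by blast
    \<comment> \<open>The square commutes, so \<open>FObj k a\<close> lies over
      \<open>FObj l b\<close>.\<close>
    then have "\<exists>c. c \<in> Obj (Src m) \<and> FObj m c = FObj l b"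
      using eqs(1)[of a] b by (intro exI[of _ "FObj k a"]) auto
    then have "\<exists>!c. c \<in> Obj (Src m) \<and> FObj m c = FObj l b"
      using cosieve_obj_inj[OF m(2)] by metis
    then show ?thesis unfolding D_def by (rule theI')
  qed
  then have [simp]: "b \<in> Obj (Tgt e) \<Longrightarrow> D b \<in> Obj (Src m)"
    "b \<in> Obj (Tgt e) \<Longrightarrow> FObj m (D b) = FObj l b" for b by auto
  \<comment> \<open>With \<open>W_eq\<close> below this is the working principle: to identify a
    value of the filler, compare images under \<open>m\<close>.\<close>
  have D_eq: "D b = c" if "b \<in> Obj (Tgt e)" "c \<in> Obj (Src m)" "FObj m c = FObj l b" for b c
    by (rule cosieve_obj_inj[OF m(2)]) (use that in auto)
  \<comment> \<open>The arrow of \<open>Src m\<close> over \<open>FArr l u\<close>, obtained by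
    lifting along \<open>m\<close> from the object that \<open>D\<close> assigns to the
    domain.\<close>
  define W where "W u = Lift m (D (Dom (Tgt e) u)) (FArr l u)" for u
  have [simp]: "W u \<in> Arr (Src m)" "Dom (Src m) (W u) = D (Dom (Tgt e) u)" "FArr m (W u) = FArr l u"
    if "u \<in> Arr (Tgt e)" for u
    using that by (auto simp: W_def)
  have [simp]: "Cod (Src m) (W u) = D (Cod (Tgt e) u)" if "u \<in> Arr (Tgt e)" for u
    by (rule D_eq[symmetric]) (use that in \<open>auto simp: W_def\<close>)
  have W_eq: "W u = w" if "u \<in> Arr (Tgt e)" "w \<in> Arr (Src m)" "FArr m w = FArr l u" for u w
    by (rule cosieve_arr_inj[OF m(2)]) (use that in auto)
  define d where "d = \<lparr>Src = Tgt e, Tgt = Src m, FObj = (\<lambda>b\<in>Obj (Tgt e). D b),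
    FArr = (\<lambda>u\<in>Arr (Tgt e). W u), Lift = (\<lambda>b w. if b \<in> Obj (Tgt e) \<and> w \<in> Arr (Src m) \<and>
      Dom (Src m) w = D b then Lift l b (FArr m w) else undefined)\<rparr>"
  have [simp]: "Src d = Tgt e" "Tgt d = Src m" "FObj d = (\<lambda>b\<in>Obj (Tgt e). D b)"
    "FArr d = (\<lambda>u\<in>Arr (Tgt e). W u)"
    "b \<in> Obj (Tgt e) \<Longrightarrow> w \<in> Arr (Src m) \<Longrightarrow> Dom (Src m) w = D b \<Longrightarrow> Lift d b w = Lift l b (FArr m w)" for b w
    by (auto simp: d_def)
  have fun_d: "is_functor d"
    by (rule is_functorI) (auto intro!: W_eq)
  have lens_d: "is_lens d"
  proof (rule is_lensI[OF fun_d])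
    fix b w v assume *: "b \<in> Obj (Src d)" "w \<in> Arr (Tgt d)" "Dom (Tgt d) w = FObj d b"
        "v \<in> Arr (Tgt d)" "Cod (Tgt d) w = Dom (Tgt d) v"
    \<comment> \<open>The second lift starts where the first one ends; this makes \<open>v\<close>
      liftable there along \<open>d\<close>.\<close>
    have "D (Cod (Tgt e) (Lift l b (FArr m w))) = Dom (Src m) v"
      by (rule D_eq) (use * in \<open>auto\<close>)
    with * show "Lift d b (Comp (Tgt d) v w) =
          Comp (Src d) (Lift d (Cod (Src d) (Lift d b w)) v) (Lift d b w)"
      by (simp add: lift_comp[OF l(1), simplified])
  qed (auto intro!: W_eq simp: d_def)
  have de: "lens_comp d e = k"
  proof (rule lens_eqI[OF is_lens_comp[OF e(1) lens_d] k(1)])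
    fix a w assume a: "a \<in> Obj (Src k)" "w \<in> Arr (Tgt k)" "Dom (Tgt k) w = FObj k a"
    have D_a: "D (FObj e a) = FObj k a" by (rule D_eq) (use a eqs in auto)
    \<comment> \<open>Comparing the two composites on the lift of \<open>FArr m w\<close> suffices,
      because \<open>m\<close> lifts that arrow back to \<open>w\<close>.\<close>
    with a eqs(3)[of a "FArr m w"] eqs(1)[of a] show "Lift (lens_comp d e) a w = Lift k a w"
      by simp
  qed (auto intro!: D_eq W_eq simp: eqs)
  have "lens_comp m d = l"
    by (rule lens_eqI[OF is_lens_comp[OF lens_d m(1)] l(1)]) auto
  with de lens_d show ?thesis by (intro that) auto
qed


section \<open>Kernel pairs and cokernel pairs\<close>

text \<open>This is the pullback of the underlying functor along itself; the lifting operation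
  enters only through the projections.\<close>

definition kernel_pair :: "('o, 'm, 'p, 'n, 'z) cat_functor_scheme \<Rightarrow> ('o \<times> 'o, 'm \<times> 'm) cat" where
  "kernel_pair f =
     (let A = Src f; W = {(w, w'). w \<in> Arr A \<and> w' \<in> Arr A \<and> FArr f w = FArr f w'};
        X = {(a, a'). a \<in> Obj A \<and> a' \<in> Obj A \<and> FObj f a = FObj f a'} in
     \<lparr>Obj = X, Arr = W,
      Dom = (\<lambda>w\<in>W. (Dom A (fst w), Dom A (snd w))),
      Cod = (\<lambda>w\<in>W. (Cod A (fst w), Cod A (snd w))),
      Ident = (\<lambda>a\<in>X. (Ident A (fst a), Ident A (snd a))),
      Comp = (\<lambda>v w. if w \<in> W \<and> v \<in> W \<and> Cod A (fst w) = Dom A (fst v) \<and>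
                       Cod A (snd w) = Dom A (snd v)
                    then (Comp A (fst v) (fst w), Comp A (snd v) (snd w)) else undefined)\<rparr>)"

lemma kernel_pair_simps [simp]:
  "(a, a') \<in> Obj (kernel_pair f) \<longleftrightarrow> a \<in> Obj (Src f) \<and> a' \<in> Obj (Src f) \<and> FObj f a = FObj f a'"
  "(w, w') \<in> Arr (kernel_pair f) \<longleftrightarrow> w \<in> Arr (Src f) \<and> w' \<in> Arr (Src f) \<and> FArr f w = FArr f w'"
  "(w, w') \<in> Arr (kernel_pair f) \<Longrightarrow> Dom (kernel_pair f) (w, w') = (Dom (Src f) w, Dom (Src f) w')"
  "(w, w') \<in> Arr (kernel_pair f) \<Longrightarrow> Cod (kernel_pair f) (w, w') = (Cod (Src f) w, Cod (Src f) w')"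
  "(a, a') \<in> Obj (kernel_pair f) \<Longrightarrow>
     Ident (kernel_pair f) (a, a') = (Ident (Src f) a, Ident (Src f) a')"
  "(w, w') \<in> Arr (kernel_pair f) \<Longrightarrow> (v, v') \<in> Arr (kernel_pair f) \<Longrightarrow>
     Cod (Src f) w = Dom (Src f) v \<Longrightarrow> Cod (Src f) w' = Dom (Src f) v' \<Longrightarrow>
     Comp (kernel_pair f) (v, v') (w, w') = (Comp (Src f) v w, Comp (Src f) v' w')"
  by (auto simp: kernel_pair_def Let_def)

lemma functor_parallel:
  assumes F: "is_functor f" and w: "w \<in> Arr (Src f)" "w' \<in> Arr (Src f)" "FArr f w = FArr f w'"
  shows "FObj f (Dom (Src f) w) = FObj f (Dom (Src f) w')"
    and "FObj f (Cod (Src f) w) = FObj f (Cod (Src f) w')"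
  using functor_dom[OF F w(1)] functor_dom[OF F w(2)] functor_cod[OF F w(1)] functor_cod[OF F w(2)]
    w by simp_all

lemma category_kernel_pair:
  assumes F: "is_functor f"
  shows "category (kernel_pair f)"
proof -
  note A = functor_src[OF F]
  note [simp] = functor_facts[OF F] category_facts[OF A]
  \<comment> \<open>Domains, codomains and their identities again form pairs with equal images.
    These equations have no natural direction, so they serve as propositions equal to
    \<open>True\<close>.\<close>
  note [simp] = functor_parallel[OF F, THEN eqTrueI]
    functor_parallel[OF F, THEN arg_cong[of _ _ "Ident (Tgt f)"], THEN eqTrueI]
  show ?thesis
  proof (unfold_locales, goal_cases)
    case 1
    then show ?case by (auto simp: kernel_pair_def Let_def)
  next
    case 2
    then show ?case by (auto simp: kernel_pair_def Let_def)
  next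
    case 3
    then show ?case by (auto simp: kernel_pair_def Let_def)
  next
    case (9 g f)
    then show ?case by (auto simp: composable_def kernel_pair_def Let_def)
  next
    case (12 h g f)
    then show ?case by (cases f; cases g; cases h) (auto simp: composable_def category.comp_assoc'[OF A])
  qed (auto simp: composable_def)
qed

definition kernel_pair_fst :: "('o, 'm, 'p, 'n) lens \<Rightarrow> ('o \<times> 'o, 'm \<times> 'm, 'o, 'm) lens" where
  "kernel_pair_fst f =
     \<lparr>Src = kernel_pair f, Tgt = Src f,
      FObj = restrict fst (Obj (kernel_pair f)), FArr = restrict fst (Arr (kernel_pair f)),
      Lift = (\<lambda>a w. if a \<in> Obj (kernel_pair f) \<and> w \<in> Arr (Src f) \<and> Dom (Src f) w = fst a
                    then (w, Lift f (snd a) (FArr f w)) else undefined)\<rparr>"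

definition kernel_pair_snd :: "('o, 'm, 'p, 'n) lens \<Rightarrow> ('o \<times> 'o, 'm \<times> 'm, 'o, 'm) lens" where
  "kernel_pair_snd f =
     \<lparr>Src = kernel_pair f, Tgt = Src f,
      FObj = restrict snd (Obj (kernel_pair f)), FArr = restrict snd (Arr (kernel_pair f)),
      Lift = (\<lambda>a w. if a \<in> Obj (kernel_pair f) \<and> w \<in> Arr (Src f) \<and> Dom (Src f) w = snd a
                    then (Lift f (fst a) (FArr f w), w) else undefined)\<rparr>"

text \<open>The pair made of \<open>w\<close> and a lift of \<open>f w\<close> lies in the kernel
  pair, since \<open>f\<close> sends both components to \<open>f w\<close>. After composition with
  \<open>f\<close>, both projections lift \<open>u\<close> at \<open>(a, a')\<close> to the pair of
  its lifts at \<open>a\<close> and at \<open>a'\<close>.\<close>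

lemma
  assumes f: "is_lens f"
  shows is_lens_kernel_pair_fst: "is_lens (kernel_pair_fst f)"
    and is_lens_kernel_pair_snd: "is_lens (kernel_pair_snd f)"
    and kernel_pair_commutes: "lens_comp f (kernel_pair_fst f) = lens_comp f (kernel_pair_snd f)"
proof -
  note F = lens_functor[OF f]
  note A = functor_src[OF F]
  have [simp]: "category (kernel_pair f)" by (rule category_kernel_pair[OF F])
  note [simp] = functor_facts[OF F] category_facts[OF A] lens_facts[OF f]
  note [simp] = functor_parallel[OF F, THEN eqTrueI]
  \<comment> \<open>In the other component, the identity to be lifted belongs to an image that
    equals \<open>FObj f a\<close> only by membership in the kernel pair.\<close>
  have [simp]: "Lift f a (Ident (Tgt f) b) = Ident (Src f) a" if "a \<in> Obj (Src f)" "FObj f a = b" for a b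
    using that by auto
  have fun1: "is_functor (kernel_pair_fst f)"
    by (rule is_functorI) (auto simp: kernel_pair_fst_def)
  show 1: "is_lens (kernel_pair_fst f)"
    by (rule is_lensI[OF fun1]) (auto simp: kernel_pair_fst_def lift_comp[OF f])
  have fun2: "is_functor (kernel_pair_snd f)"
    by (rule is_functorI) (auto simp: kernel_pair_snd_def)
  show 2: "is_lens (kernel_pair_snd f)"
    by (rule is_lensI[OF fun2]) (auto simp: kernel_pair_snd_def lift_comp[OF f])
  show "lens_comp f (kernel_pair_fst f) = lens_comp f (kernel_pair_snd f)"
    by (rule lens_eqI[OF is_lens_comp[OF 1 f] is_lens_comp[OF 2 f]])
      (auto simp: kernel_pair_fst_def kernel_pair_snd_def)
qed

text \<open>Two copies of \<open>C\<close> glued along the objects in \<open>S\<close>, which carry only the tag \<open>False\<close>;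
  an arrow is tagged like its domain.\<close>

definition double :: "('o, 'm) cat \<Rightarrow> 'o set \<Rightarrow> ('o \<times> bool, 'm \<times> bool) cat" where
  "double C S =
     (let X = {(x, t). x \<in> Obj C \<and> \<not> (t \<and> x \<in> S)}; W = {(w, t). w \<in> Arr C \<and> \<not> (t \<and> Dom C w \<in> S)} in
     \<lparr>Obj = X, Arr = W,
      Dom = (\<lambda>(w, t)\<in>W. (Dom C w, t)),
      Cod = (\<lambda>(w, t)\<in>W. (Cod C w, t \<and> Cod C w \<notin> S)),
      Ident = (\<lambda>(x, t)\<in>X. (Ident C x, t)),
      Comp = (\<lambda>v w. if w \<in> W \<and> v \<in> W \<and> Cod C (fst w) = Dom C (fst v) \<and>
                       snd v = (snd w \<and> Cod C (fst w) \<notin> S)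
                    then (Comp C (fst v) (fst w), snd w) else undefined)\<rparr>)"

lemma double_simps [simp]:
  "(x, t) \<in> Obj (double C S) \<longleftrightarrow> x \<in> Obj C \<and> \<not> (t \<and> x \<in> S)"
  "(w, t) \<in> Arr (double C S) \<longleftrightarrow> w \<in> Arr C \<and> \<not> (t \<and> Dom C w \<in> S)"
  "(w, t) \<in> Arr (double C S) \<Longrightarrow> Dom (double C S) (w, t) = (Dom C w, t)"
  "(w, t) \<in> Arr (double C S) \<Longrightarrow> Cod (double C S) (w, t) = (Cod C w, t \<and> Cod C w \<notin> S)"
  "(x, t) \<in> Obj (double C S) \<Longrightarrow> Ident (double C S) (x, t) = (Ident C x, t)"
  "(w, t) \<in> Arr (double C S) \<Longrightarrow> (v, s) \<in> Arr (double C S) \<Longrightarrow> Cod C w = Dom C v \<Longrightarrow>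
     s = (t \<and> Cod C w \<notin> S) \<Longrightarrow> Comp (double C S) (v, s) (w, t) = (Comp C v w, t)"
  by (auto simp: double_def Let_def)

text \<open>Closure of \<open>S\<close> under outgoing arrows makes the tags consistent: a path that
  has entered \<open>S\<close> never leaves it, so the tag changes at most once, from
  \<open>True\<close> to \<open>False\<close>.\<close>

lemma category_double:
  assumes C: "category C" and S: "\<And>w. w \<in> Arr C \<Longrightarrow> Dom C w \<in> S \<Longrightarrow> Cod C w \<in> S"
  shows "category (double C S)"
proof -
  note [simp] = category_facts[OF C]
  show ?thesis
  proof (unfold_locales, goal_cases)
    case 1
    then show ?case by (auto simp: double_def Let_def)
  next
    case 2
    then show ?case by (auto simp: double_def Let_def)
  next
    case 3
    then show ?case by (auto simp: double_def Let_def)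
  next
    case (9 g f)
    then show ?case by (auto simp: composable_def double_def Let_def)
  next
    case (12 h g f)
    then show ?case
      by (cases f; cases g; cases h) (auto simp: composable_def category.comp_assoc'[OF C] S;
        subst double_simps(6); auto simp: category.comp_assoc'[OF C] dest: S)
  qed (auto simp: composable_def S)
qed

text \<open>The inclusion of the copy with tag \<open>t\<close>; the tag is dropped over
  \<open>S\<close>, where only one copy exists.\<close>

definition double_functor :: "('o, 'm) cat \<Rightarrow> 'o set \<Rightarrow> bool \<Rightarrow> ('o, 'm, 'o \<times> bool, 'm \<times> bool) cat_functor"
  where "double_functor C S t =
     \<lparr>Src = C, Tgt = double C S,
      FObj = (\<lambda>x\<in>Obj C. (x, t \<and> x \<notin> S)), FArr = (\<lambda>w\<in>Arr C. (w, t \<and> Dom C w \<notin> S))\<rparr>"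

text \<open>An arrow that starts at an object of one copy has the tag of that object, so it comes
  from that copy.\<close>

lemma discrete_opfibration_double_functor:
  assumes C: "category C" and S: "\<And>w. w \<in> Arr C \<Longrightarrow> Dom C w \<in> S \<Longrightarrow> Cod C w \<in> S"
  shows "discrete_opfibration (double_functor C S t)"
proof -
  note [simp] = category_facts[OF C]
  have "FArr (double_functor C S t) (Comp C w' w) =
      Comp (double C S) (FArr (double_functor C S t) w') (FArr (double_functor C S t) w)"
    if "w \<in> Arr C" "w' \<in> Arr C" "Cod C w = Dom C w'" for w w'
    \<comment> \<open>If \<open>w\<close> starts in \<open>S\<close>, then so does
      \<open>w'\<close>, and both tags are \<open>False\<close>.\<close>
    using that S[of w] by (cases "Dom C w \<in> S") (auto simp: double_functor_def)
  then have "is_functor (double_functor C S t)"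
    by (intro is_functorI) (use C S in \<open>auto simp: double_functor_def intro!: category_double\<close>)
  then show ?thesis
    by (rule discrete_opfibrationI) (auto simp: double_functor_def inj_on_def)
qed

text \<open>Cancellation is assumed for lenses into categories on the product types, since the glued
  copies live there; the two inclusions bound the size of these categories.\<close>

lemma surjective_if_cancel_double:
  fixes f :: "('o, 'm, 'p, 'n) lens"
  assumes f: "is_lens f"
    and cancel: "\<And>g h :: ('p, 'n, 'p \<times> bool, 'n \<times> bool) lens.
      is_lens g \<Longrightarrow> is_lens h \<Longrightarrow> Src g = Tgt f \<Longrightarrow> Src h = Tgt f \<Longrightarrow> Tgt g = Tgt h \<Longrightarrow>
      Obj (Tgt h) \<subseteq> Obj (Tgt f) \<times> UNIV \<Longrightarrow> Arr (Tgt h) \<subseteq> Arr (Tgt f) \<times> UNIV \<Longrightarrow>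
      lens_comp g f = lens_comp h f \<Longrightarrow> g = h"
  shows "surjective_on_objects f"
proof -
  note F = lens_functor[OF f]
  note [simp] = functor_facts[OF F] category_facts[OF functor_src[OF F]] lens_facts[OF f]
    category_facts[OF functor_tgt[OF F]]
  define S where "S = FObj f ` Obj (Src f)"
  note up = lens_image_closed[OF f, folded S_def]
  have inS [simp]: "FObj f a \<in> S" if "a \<in> Obj (Src f)" for a using that by (auto simp: S_def)
  define g where "g t = opfibration_lens (double_functor (Tgt f) S t)" for t
  have opf: "discrete_opfibration (double_functor (Tgt f) S t)" for t
    by (rule discrete_opfibration_double_functor) (auto intro: up)
  then have lens_g: "is_lens (g t)" for t
    unfolding g_def by (rule is_lens_opfibration_lens)
  have [simp]: "Src (g t) = Tgt f" "Tgt (g t) = double (Tgt f) S"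
    "FObj (g t) = (\<lambda>x\<in>Obj (Tgt f). (x, t \<and> x \<notin> S))"
    "FArr (g t) = (\<lambda>w\<in>Arr (Tgt f). (w, t \<and> Dom (Tgt f) w \<notin> S))" for t
    by (auto simp: g_def double_functor_def)
  have g_Lift: "Lift (g t) b (u, False) = u"
    if "u \<in> Arr (Tgt f)" "Dom (Tgt f) u = b" "b \<in> S" for t b u
    unfolding g_def
    by (rule opfibration_lens_Lift[OF opf]) (use that in \<open>auto simp: double_functor_def\<close>)
  \<comment> \<open>The image of \<open>f\<close> lies in \<open>S\<close>, where the two inclusions
    agree on objects, on arrows and on lifts.\<close>
  have eq: "lens_comp (g True) f = lens_comp (g False) f"
    by (rule lens_eqI) (auto intro!: is_lens_comp f lens_g simp: g_Lift)
  have "g True = g False"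
    by (rule cancel) (auto intro: lens_g eq)
  \<comment> \<open>Outside \<open>S\<close> the two images of an object would have different
    tags.\<close>
  from arg_cong[OF this, of FObj] have "b \<in> S" if "b \<in> Obj (Tgt f)" for b
    using that by (auto dest: fun_cong[of _ _ b])
  then show ?thesis
    unfolding surjective_on_objects_def S_def[symmetric] by (auto simp: S_def)
qed

text \<open>Evaluating the projections at a pair with equal images gives injectivity on objects and
  on arrows; existence of lifts is part of being a lens.\<close>

lemma cosieve_if_cancel_kernel_pair:
  assumes f: "is_lens f" and eq: "kernel_pair_fst f = kernel_pair_snd f"
  shows "cosieve f"
proof -
  note F = lens_functor[OF f]
  note [simp] = lens_facts[OF f]
  have "a = a'" if "a \<in> Obj (Src f)" "a' \<in> Obj (Src f)" "FObj f a = FObj f a'" for a a'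
    using arg_cong[OF eq, of "\<lambda>g. FObj g (a, a')"] that
    by (simp add: kernel_pair_fst_def kernel_pair_snd_def)
  moreover have "w = w'" if "w \<in> Arr (Src f)" "w' \<in> Arr (Src f)" "FArr f w = FArr f w'" for w w'
    using arg_cong[OF eq, of "\<lambda>g. FArr g (w, w')"] that
    by (simp add: kernel_pair_fst_def kernel_pair_snd_def)
  ultimately have "inj_on (FObj f) (Obj (Src f))" "inj_on (FArr f) (Arr (Src f))"
    by (auto simp: inj_on_def)
  moreover have "\<exists>w. w \<in> Arr (Src f) \<and> Dom (Src f) w = a \<and> FArr f w = u"
    if "a \<in> Obj (Src f)" "u \<in> Arr (Tgt f)" "Dom (Tgt f) u = FObj f a" for a u
    using that by (intro exI[of _ "Lift f a u"]) simp
  ultimately show ?thesis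
    unfolding cosieve_def by (intro conjI discrete_opfibrationI[OF F])
qed

section \<open>Replacing a category by an isomorphic small one\<close>

definition transport_category ::
    "('o \<Rightarrow> 'p) \<Rightarrow> ('m \<Rightarrow> 'n) \<Rightarrow> ('o, 'm) cat \<Rightarrow> ('p, 'n) cat" where
  "transport_category i j C =
     (let i' = inv_into (Obj C) i; j' = inv_into (Arr C) j in
     \<lparr>Obj = i ` Obj C, Arr = j ` Arr C,
      Dom = (\<lambda>w\<in>j ` Arr C. i (Dom C (j' w))), Cod = (\<lambda>w\<in>j ` Arr C. i (Cod C (j' w))),
      Ident = (\<lambda>x\<in>i ` Obj C. j (Ident C (i' x))),
      Comp = (\<lambda>v w. if w \<in> j ` Arr C \<and> v \<in> j ` Arr C \<and> Cod C (j' w) = Dom C (j' v)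
                    then j (Comp C (j' v) (j' w)) else undefined)\<rparr>)"

text \<open>The lenses \<open>s\<close> and \<open>t\<close> are the two directions of the
  isomorphism with the copy. Recorded is what cancellation requires: \<open>s\<close> is a cosieve
  and \<open>t\<close> is surjective on objects.\<close>

lemma transport_exists:
  fixes C :: "('o, 'm) cat" and i :: "'o \<Rightarrow> 'p" and j :: "'m \<Rightarrow> 'n"
  assumes C: "category C" and i: "inj_on i (Obj C)" and j: "inj_on j (Arr C)"
  obtains s :: "('o, 'm, 'p, 'n) lens" and t :: "('p, 'n, 'o, 'm) lens"
  where "is_lens s" "cosieve s" "is_lens t" "surjective_on_objects t" "Src s = C" "Tgt t = C"
    "Src t = Tgt s" "Obj (Tgt s) = i ` Obj C" "Arr (Tgt s) = j ` Arr C"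
proof -
  define D where "D = transport_category i j C"
  note [simp] = category_facts[OF C] inv_into_f_f[OF i] inv_into_f_f[OF j]
  note [simp] = inj_on_eq_iff[OF i] inj_on_eq_iff[OF j]
  have D_simps [simp]:
    "Obj D = i ` Obj C" "Arr D = j ` Arr C"
    "w \<in> Arr C \<Longrightarrow> Dom D (j w) = i (Dom C w)"
    "w \<in> Arr C \<Longrightarrow> Cod D (j w) = i (Cod C w)"
    "x \<in> Obj C \<Longrightarrow> Ident D (i x) = j (Ident C x)"
    "w \<in> Arr C \<Longrightarrow> v \<in> Arr C \<Longrightarrow> Cod C w = Dom C v \<Longrightarrow> Comp D (j v) (j w) = j (Comp C v w)"
    for w v x
    by (auto simp: D_def transport_category_def Let_def)
  have cat_D [simp]: "category D"
  proof (unfold_locales, goal_cases)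
    case 1
    then show ?case by (auto simp: D_def transport_category_def Let_def)
  next
    case 2
    then show ?case by (auto simp: D_def transport_category_def Let_def)
  next
    case 3
    then show ?case by (auto simp: D_def transport_category_def Let_def)
  next
    case (9 g f)
    then show ?case by (auto simp: composable_def) (auto simp: D_def transport_category_def Let_def)
  next
    case (12 h g f)
    then show ?case
      by (auto simp: composable_def category.comp_assoc'[OF C])
  qed (auto simp: composable_def)
  define s where "s = \<lparr>Src = C, Tgt = D, FObj = restrict i (Obj C), FArr = restrict j (Arr C)\<rparr>"
  have [simp]: "Src s = C" "Tgt s = D" "FObj s = restrict i (Obj C)" "FArr s = restrict j (Arr C)"
    by (auto simp: s_def)
  have fs: "is_functor s" by (rule is_functorI) (use C in auto)
  have s: "discrete_opfibration s"
    by (rule discrete_opfibrationI[OF fs]) (use j in \<open>auto simp: inj_on_def\<close>)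
  have cs: "cosieve s" using s i by (auto simp: cosieve_def inj_on_def)
  define t where "t = \<lparr>Src = D, Tgt = C, FObj = restrict (inv_into (Obj C) i) (i ` Obj C),
    FArr = restrict (inv_into (Arr C) j) (j ` Arr C)\<rparr>"
  have [simp]: "Src t = D" "Tgt t = C" "FObj t = restrict (inv_into (Obj C) i) (i ` Obj C)"
    "FArr t = restrict (inv_into (Arr C) j) (j ` Arr C)"
    by (auto simp: t_def)
  have ft: "is_functor t" by (rule is_functorI) (use C in auto)
  have t: "discrete_opfibration t"
    by (rule discrete_opfibrationI[OF ft]) (auto simp: inj_on_def)
  have surj: "surjective_on_objects (opfibration_lens t)"
    by (simp add: surjective_on_objects_def image_image)
  show ?thesis
    by (rule that[OF is_lens_opfibration_lens[OF s] _ is_lens_opfibration_lens[OF t] surj])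
      (simp_all add: cs)
qed

section \<open>Cardinalities of products\<close>

lemma lesspoll_iff_ordLess: "A \<prec> B \<longleftrightarrow> (card_of A, card_of B) \<in> ordLess"
proof -
  have le: "X \<lesssim> Y \<longleftrightarrow> (card_of X, card_of Y) \<in> ordLeq" for X :: "'x set" and Y :: "'y set"
    unfolding lepoll_def by (rule card_of_ordLeq)
  \<comment> \<open>Comparability of cardinals turns \<open>A \<prec> B\<close> into the failure of
    \<open>B \<lesssim> A\<close>.\<close>
  have "A \<lesssim> B \<or> B \<lesssim> A"
    unfolding le by (rule ordLeq_total) (rule card_of_Well_order)+
  then have "A \<prec> B \<longleftrightarrow> \<not> B \<lesssim> A"
    unfolding lesspoll_def using lepoll_antisym eqpoll_imp_lepoll eqpoll_sym by blast
  then show ?thesis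
    unfolding le by (simp add: not_ordLeq_iff_ordLess card_of_Well_order)
qed

text \<open>If the factors are nonempty and not both finite, the product has the cardinality of the
  larger factor; otherwise the product is finite.\<close>

lemma Times_lesspoll_infinite:
  assumes C: "infinite C" and less: "A \<prec> C" "B \<prec> C"
  shows "A \<times> B \<prec> C"
proof (cases "(finite A \<and> finite B) \<or> A = {} \<or> B = {}")
  case True
  then show ?thesis using C by (auto intro!: finite_lesspoll_infinite)
next
  case False
  consider "(card_of B, card_of A) \<in> ordLeq" | "(card_of A, card_of B) \<in> ordLeq"
    using ordLeq_total[OF card_of_Well_order card_of_Well_order] by blast
  then show ?thesis
  proof cases
    case 1
    with False have "infinite A" using card_of_ordLeq_finite[OF 1] by auto
    then have "(card_of (A \<times> B), card_of A) \<in> ordIso"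
      using card_of_Times_infinite[OF _ _ 1] False by auto
    then show ?thesis
      using less(1) unfolding lesspoll_iff_ordLess by (rule ordIso_ordLess_trans)
  next
    case 2
    with False have "infinite B" using card_of_ordLeq_finite[OF 2] by auto
    then have "(card_of (A \<times> B), card_of B) \<in> ordIso"
      using card_of_Times_infinite[OF _ _ 2] False by auto
    then show ?thesis
      using less(2) unfolding lesspoll_iff_ordLess by (rule ordIso_ordLess_trans)
  qed
qed

lemma small_transport_exists:
  fixes C :: "('o, 'm) cat"
  assumes C: "category C" "Obj C \<prec> (UNIV :: 'u set)" "Arr C \<prec> (UNIV :: 'u set)"
  obtains s :: "('o, 'm, 'u, 'u) lens" and t :: "('u, 'u, 'o, 'm) lens"
  where "is_lens s" "cosieve s" "is_lens t" "surjective_on_objects t" "Src s = C" "Tgt t = C"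
    "small_category (Tgt s)" "small_category (Src t)"
proof -
  obtain i :: "'o \<Rightarrow> 'u" and j :: "'m \<Rightarrow> 'u" where ij: "inj_on i (Obj C)" "inj_on j (Arr C)"
    using lesspoll_imp_lepoll[OF C(2)] lesspoll_imp_lepoll[OF C(3)] unfolding lepoll_def by blast
  obtain s :: "('o, 'm, 'u, 'u) lens" and t :: "('u, 'u, 'o, 'm) lens"
    where st: "is_lens s" "cosieve s" "is_lens t" "surjective_on_objects t" "Src s = C" "Tgt t = C"
    "Src t = Tgt s" "Obj (Tgt s) = i ` Obj C" "Arr (Tgt s) = j ` Arr C"
    by (rule transport_exists[OF C(1) ij])
  have sm: "small_category (Tgt s)"
    unfolding small_category_def st(8,9)
    using C(2,3) ij functor_tgt[OF lens_functor[OF st(1)]] by simp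
  show ?thesis by (rule that[OF st(1-6) sm]) (simp add: st(7) sm)
qed

section \<open>The factorisation system\<close>

lemma is_epi_Lens_iff:
  "is_epi Lens f \<longleftrightarrow> small_lens f \<and> (\<forall>g h. small_lens g \<and> small_lens h \<and> Src g = Tgt f \<and>
     Src h = Tgt f \<and> Tgt g = Tgt h \<and> lens_comp g f = lens_comp h f \<longrightarrow> g = h)"
  unfolding is_epi_def composable_Lens by (intro conj_cong iff_allI) auto

lemma is_mono_Lens_iff:
  "is_mono Lens f \<longleftrightarrow> small_lens f \<and> (\<forall>g h. small_lens g \<and> small_lens h \<and> Tgt g = Src f \<and>
     Tgt h = Src f \<and> Src g = Src h \<and> lens_comp f g = lens_comp f h \<longrightarrow> g = h)"
  unfolding is_mono_def composable_Lens by (intro conj_cong iff_allI) auto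

text \<open>The test lenses \<open>g\<close> and \<open>h\<close> are moved into \<open>Lens\<close>
  by composing with a cosieve \<open>s\<close> onto a small copy of their target. There
  \<open>f\<close> cancels, and afterwards \<open>s\<close> does.\<close>

lemma epi_surjective:
  fixes f :: "('u, 'u, 'u, 'u) lens"
  assumes inf: "infinite (UNIV :: 'u set)" and epi: "is_epi Lens f"
  shows "surjective_on_objects f"
proof -
  have f: "small_lens f" using epi by (simp add: is_epi_def)
  note fD = small_lensD[OF f]
  show ?thesis
  proof (rule surjective_if_cancel_double[OF fD(1)])
    fix g h :: "('u, 'u, 'u \<times> bool, 'u \<times> bool) lens"
    assume g: "is_lens g" "Src g = Tgt f" and h: "is_lens h" "Src h = Tgt f" and T: "Tgt g = Tgt h"
      and sub: "Obj (Tgt h) \<subseteq> Obj (Tgt f) \<times> UNIV" "Arr (Tgt h) \<subseteq> Arr (Tgt f) \<times> UNIV"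
      and eq: "lens_comp g f = lens_comp h f"
    \<comment> \<open>Doubling a small set keeps it small because \<open>'u\<close> is
      infinite.\<close>
    have size: "X \<prec> (UNIV :: 'u set)" if "X \<subseteq> Y \<times> (UNIV :: bool set)" "Y \<prec> (UNIV :: 'u set)"
      for X and Y :: "'u set"
    proof (rule lesspoll_trans1)
      show "X \<lesssim> Y \<times> (UNIV :: bool set)" using that(1) by (rule subset_imp_lepoll)
      show "Y \<times> (UNIV :: bool set) \<prec> (UNIV :: 'u set)"
        by (rule Times_lesspoll_infinite[OF inf that(2) finite_lesspoll_infinite[OF inf finite]])
    qed
    have "Obj (Tgt h) \<prec> (UNIV :: 'u set)" "Arr (Tgt h) \<prec> (UNIV :: 'u set)"
      using size[OF sub(1)] size[OF sub(2)] fD(3) by (auto simp: small_category_def)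
    with functor_tgt[OF lens_functor[OF h(1)]]
    obtain s :: "('u \<times> bool, 'u \<times> bool, 'u, 'u) lens" and t :: "('u, 'u, 'u \<times> bool, 'u \<times> bool) lens"
      where s: "is_lens s" "cosieve s" "is_lens t" "surjective_on_objects t"
      "Src s = Tgt h" "Tgt t = Tgt h" "small_category (Tgt s)" "small_category (Src t)"
      by (rule small_transport_exists)
    have "small_lens (lens_comp s g)" "small_lens (lens_comp s h)"
      using s g h T fD by (auto simp: small_lens_def intro!: is_lens_comp)
    moreover have "lens_comp (lens_comp s g) f = lens_comp (lens_comp s h) f"
      using s g h T fD eq by (simp flip: lens_comp_assoc)
    ultimately have "lens_comp s g = lens_comp s h"
      using epi g h T by (simp add: is_epi_Lens_iff)
    then show "g = h"
      using s g h T by (auto intro: cosieve_cancel[of s g h])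
  qed
qed

text \<open>Dually, the projections are moved into \<open>Lens\<close> by precomposing with a
  surjective \<open>t\<close> from a small copy of the kernel pair; first \<open>f\<close> cancels,
  then \<open>t\<close>.\<close>

lemma mono_cosieve:
  fixes f :: "('u, 'u, 'u, 'u) lens"
  assumes inf: "infinite (UNIV :: 'u set)" and mono: "is_mono Lens f"
  shows "cosieve f"
proof -
  have f: "small_lens f" using mono by (simp add: is_mono_def)
  note fD = small_lensD[OF f]
  define K where "K = kernel_pair f"
  note k = is_lens_kernel_pair_fst[OF fD(1)] is_lens_kernel_pair_snd[OF fD(1)]
  have [simp]: "Src (kernel_pair_fst f) = K" "Src (kernel_pair_snd f) = K"
    "Tgt (kernel_pair_fst f) = Src f" "Tgt (kernel_pair_snd f) = Src f"
    by (auto simp: K_def kernel_pair_fst_def kernel_pair_snd_def)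
  have "Obj K \<subseteq> Obj (Src f) \<times> Obj (Src f)" "Arr K \<subseteq> Arr (Src f) \<times> Arr (Src f)"
    by (auto simp: K_def)
  moreover have "Obj (Src f) \<times> Obj (Src f) \<prec> (UNIV :: 'u set)"
    "Arr (Src f) \<times> Arr (Src f) \<prec> (UNIV :: 'u set)"
    using fD(2) inf by (auto simp: small_category_def intro: Times_lesspoll_infinite)
  ultimately have "Obj K \<prec> (UNIV :: 'u set)" "Arr K \<prec> (UNIV :: 'u set)"
    using lesspoll_trans1 subset_imp_lepoll by blast+
  moreover have "category K"
    using functor_src[OF lens_functor[OF k(1)]] by simp
  ultimately obtain s :: "('u \<times> 'u, 'u \<times> 'u, 'u, 'u) lens" and t :: "('u, 'u, 'u \<times> 'u, 'u \<times> 'u) lens"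
    where t: "is_lens s" "cosieve s" "is_lens t" "surjective_on_objects t"
      "Src s = K" "Tgt t = K" "small_category (Tgt s)" "small_category (Src t)"
    using small_transport_exists by blast
  have "small_lens (lens_comp (kernel_pair_fst f) t)" "small_lens (lens_comp (kernel_pair_snd f) t)"
    using t k fD by (auto simp: small_lens_def intro!: is_lens_comp)
  moreover have "lens_comp f (lens_comp (kernel_pair_fst f) t) =
      lens_comp f (lens_comp (kernel_pair_snd f) t)"
    using t k fD kernel_pair_commutes[OF fD(1)] by (simp add: lens_comp_assoc)
  ultimately have "lens_comp (kernel_pair_fst f) t = lens_comp (kernel_pair_snd f) t"
    using mono t by (simp add: is_mono_Lens_iff)
  then have "kernel_pair_fst f = kernel_pair_snd f"
    using t k by (auto intro: surjective_cancel[of t])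
  then show ?thesis by (rule cosieve_if_cancel_kernel_pair[OF fD(1)])
qed

lemma surjective_epi:
  assumes "small_lens f" "surjective_on_objects f"
  shows "is_epi Lens f"
  unfolding is_epi_Lens_iff using assms surjective_cancel[of f] small_lensD(1) by auto

lemma cosieve_mono:
  assumes "small_lens f" "cosieve f"
  shows "is_mono Lens f"
  unfolding is_mono_Lens_iff using assms cosieve_cancel[of f] small_lensD(1) by auto

lemma surjective_lenses_eq:
  assumes "infinite (UNIV :: 'u set)"
  shows "(surjective_lenses :: ('u, 'u, 'u, 'u) lens set) = {f. is_epi Lens f}"
  using epi_surjective[OF assms] surjective_epi
  by (auto simp: surjective_lenses_def is_epi_def)

lemma cosieve_lenses_eq:
  assumes "infinite (UNIV :: 'u set)"
  shows "(cosieve_lenses :: ('u, 'u, 'u, 'u) lens set) = {f. is_mono Lens f}"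
  using mono_cosieve[OF assms] cosieve_mono
  by (auto simp: cosieve_lenses_def is_mono_def)

theorem theorem4p17:
  assumes "infinite (UNIV :: 'u set)"
  shows "orthogonal_factorisation_system Lens
           (surjective_lenses :: ('u, 'u, 'u, 'u) lens set) cosieve_lenses \<and>
         (surjective_lenses :: ('u, 'u, 'u, 'u) lens set) = {f. is_epi Lens f} \<and>
         (cosieve_lenses :: ('u, 'u, 'u, 'u) lens set) = {f. is_mono Lens f}"
proof (intro conjI)
  note E = surjective_lenses_eq[OF assms] and M = cosieve_lenses_eq[OF assms]
  show "surjective_lenses = {f :: ('u, 'u, 'u, 'u) lens. is_epi Lens f}" by (rule E)
  show "cosieve_lenses = {f :: ('u, 'u, 'u, 'u) lens. is_mono Lens f}" by (rule M)
  interpret L: category "Lens :: (('u, 'u) cat, ('u, 'u, 'u, 'u) lens) cat" by (rule lens_category)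
  show "orthogonal_factorisation_system Lens
      (surjective_lenses :: ('u, 'u, 'u, 'u) lens set) cosieve_lenses"
  proof (unfold_locales, goal_cases)
    \<comment> \<open>Isomorphisms and composites are handled through the description of the two
      classes as epis and monos.\<close>
    case (3 f)
    then show ?case unfolding E by (simp add: L.iso_imp_epi)
  next
    case (4 f)
    then show ?case unfolding M by (simp add: L.iso_imp_mono)
  next
    case (5 f g)
    then show ?case unfolding E by (simp add: L.epi_comp)
  next
    case (6 f g)
    then show ?case unfolding M by (simp add: L.mono_comp)
  next
    case (7 f)
    then have f: "small_lens f" by simp
    obtain e m :: "('u, 'u, 'u, 'u) lens" where em: "is_lens e" "surjective_on_objects e"
      "is_lens m" "cosieve m" "lens_comp m e = f" "Src e = Src f" "Tgt m = Tgt f" "Tgt e = Src m"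
      "Obj (Src m) \<subseteq> Obj (Tgt f)" "Arr (Src m) \<subseteq> Arr (Tgt f)"
      using factorisation_exists[OF small_lensD(1)[OF f]] by metis
    \<comment> \<open>The middle category has its objects and arrows among those of
      \<open>Tgt f\<close>.\<close>
    have "small_category (Src m)"
      using small_lensD(3)[OF f] em(9,10) functor_src[OF lens_functor[OF em(3)]]
      unfolding small_category_def by (meson lesspoll_trans1 subset_imp_lepoll)
    with em small_lensD[OF f] have "small_lens e" "small_lens m"
      by (auto simp: small_lens_def)
    with em show ?case
      by (intro bexI[of _ e] bexI[of _ m])
        (auto simp: surjective_lenses_def cosieve_lenses_def composable_Lens)
  next
    case (8 e m)
    then have e: "small_lens e" "surjective_on_objects e" and m: "small_lens m" "cosieve m"
      by (auto simp: surjective_lenses_def cosieve_lenses_def)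
    note eD = small_lensD[OF e(1)] and mD = small_lensD[OF m(1)]
    show ?case unfolding orthogonal_arrows_def
    proof (intro allI impI)
      fix k l assume "composable Lens m k \<and> composable Lens l e \<and> Comp Lens m k = Comp Lens l e"
      then have k: "small_lens k" "Tgt k = Src m" and l: "small_lens l" "Src l = Tgt e"
        and eq: "lens_comp m k = lens_comp l e"
        by (auto simp: composable_Lens)
      have kl: "Src k = Src e" "Tgt l = Tgt m"
        using arg_cong[OF eq, of Src] arg_cong[OF eq, of Tgt] by simp_all
      obtain d where d: "is_lens d" "Src d = Tgt e" "Tgt d = Src m" "lens_comp d e = k"
        "lens_comp m d = l"
        using filler_exists[OF eD(1) e(2) mD(1) m(2) _ kl(1) k(2) _ l(2) kl(2) eq] small_lensD(1) k l
        by metis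
      then have d': "small_lens d" using eD mD by (simp add: small_lens_def)
      show "\<exists>!d. composable Lens d e \<and> composable Lens m d \<and> Comp Lens d e = k \<and> Comp Lens m d = l"
      proof (rule ex1I[of _ d])
        show "composable Lens d e \<and> composable Lens m d \<and> Comp Lens d e = k \<and> Comp Lens m d = l"
          using d d' e m by (simp add: composable_Lens)
      next
        fix d2 assume d2: "composable Lens d2 e \<and> composable Lens m d2 \<and> Comp Lens d2 e = k \<and> Comp Lens m d2 = l"
        then have "small_lens d2" "Src d2 = Tgt e" "Tgt d2 = Src m" "lens_comp m d2 = l"
          by (auto simp: composable_Lens)
        \<comment> \<open>Both fillers become \<open>l\<close> after the cosieve \<open>m\<close>,
          which cancels.\<close>
        then show "d2 = d"
          using cosieve_cancel[OF mD(1) m(2)] d small_lensD(1) by metis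
      qed
    qed
  qed (auto simp: surjective_lenses_def cosieve_lenses_def)
qed

end
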